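(* Let $\mathcal{R}$ be a principal ideal ring and let $\mathcal{R}[x]=\mathcal{R}[x_1,\dots,x_N]$ with a fixed global monomial order $<$. Let $a,b,u,v\in\mathcal{R}$ be elements with $1=ua+vb$ and $ab=0$. Let $I\subseteq\mathcal{R}[x]$ be an ideal. Let $\mathcal{K},\mathcal{L}$ be finite index sets and let $G_a=(g_{a,k})_{k\in\mathcal{K}}$ and $G_b=(g_{b,l})_{l\in\mathcal{L}}$ be strong Gr\"obner bases of $I+a\mathcal{R}[x]$ and $I+b\mathcal{R}[x]$ respectively, satisfying the following conditions: (1) for $k\in\mathcal{K}$, if $g_{a,k}$ is non-constant, then $\mathrm{lc}(g_{a,k})$ divides $a$ and $\mathrm{lc}(g_{a,k})\notin a\mathcal{R}$; (2) for $l\in\mathcal{L}$, if $g_{b,l}$ is non-constant, then $\mathrm{lc}(g_{b,l})$ divides $b$ and $\mathrm{lc}(g_{b,l})\notin b\mathcal{R}$. For $k\in\mathcal{K}$, $l\in\mathcal{L}$ define $$f_{k,l}=ua\,\frac{\mathrm{lcm}(\mathrm{lm}(g_{a,k}),\mathrm{lm}(g_{b,l}))}{\mathrm{lm}(g_{b,l})}\cdot\mathrm{lc}(g_{a,k})\,g_{b,l}+vb\,\frac{\mathrm{lcm}(\mathrm{lm}(g_{a,k}),\mathrm{lm}(g_{b,l}))}{\mathrm{lm}(g_{a,k})}\cdot\mathrm{lc}(g_{b,l})\,g_{a,k}.$$ Then $G=\{f_{k,l}\mid k\in\mathcal{K},\,l\in\mathcal{L}\}$ is a strong Gr\"obner basis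 of $I$.
   Context: A principal ideal ring is a unital commutative ring in which every ideal is principal (not necessarily a domain). A monomial order is global if $x^\alpha\ge 1$ for all exponents $\alpha$. For a nonzero polynomial $f$, $\mathrm{lm}(f)$ is its largest monomial with respect to $<$, $\mathrm{lc}(f)$ the coefficient of that monomial (lead coefficient), and $\mathrm{lt}(f)=\mathrm{lc}(f)\,\mathrm{lm}(f)$ (lead term). For a set $F$ of polynomials, $L(F)$ is the ideal generated by the $\mathrm{lt}(f)$ with $0\neq f\in F$. A finite subset $G\subset\mathcal{R}[x]$ is a Gr\"obner basis of an ideal $J\subseteq\mathcal{R}[x]$ if $G\subset J$ and $L(G)=L(J)$; it is a strong Gr\"obner basis of $J$ if moreover for every $f\in J\setminus\{0\}$ there is a nonzero $g\in G$ with $\mathrm{lt}(g)\mid\mathrm{lt}(f)$. Zero elements in such a set are permitted and play no role. If $g_{a,k}=0$ or $g_{b,l}=0$ (so that lead data are undefined), put $f_{k,l}=0$. *)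

theory Defs
  imports Complex_Main "HOL-Library.Poly_Mapping" "HOL-Library.Set_Algebras"
begin

text \<open>
  A commutative ring is a module over itself; its submodules are its ideals, and the span of a
  subset is the ideal generated by it.
\<close>

global_interpretation ideal: module "(*) :: 'a::comm_ring_1 \<Rightarrow> 'a \<Rightarrow> 'a"
  by standard (simp_all add: algebra_simps)

definition principal_ideal_ring :: "'a::comm_ring_1 itself \<Rightarrow> bool"
  where "principal_ideal_ring _ \<longleftrightarrow>
    (\<forall>J :: 'a set. ideal.subspace J \<longrightarrow> (\<exists>c. J = ideal.span {c}))"

text \<open>
  Monomials in variables indexed by \<open>'n\<close> are represented by their exponent vectors, so that
  multiplication of monomials is \<open>+\<close>, the monomial 1 is \<open>0\<close>, and \<open>s - t\<close> is the quotient of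
  \<open>s\<close> by \<open>t\<close> whenever \<open>t\<close> divides \<open>s\<close>.
\<close>

type_synonym 'n mon = "'n \<Rightarrow>\<^sub>0 nat"
type_synonym ('n, 'a) mpoly = "'n mon \<Rightarrow>\<^sub>0 'a"

text \<open>The argument is the strict order relation.\<close>

definition global_monomial_order :: "('n::finite mon \<Rightarrow> 'n mon \<Rightarrow> bool) \<Rightarrow> bool"
  where "global_monomial_order lessM \<longleftrightarrow>
    irreflp lessM \<and> transp lessM \<and> totalp lessM \<and>
    (\<forall>s t w. lessM s t \<longrightarrow> lessM (s + w) (t + w)) \<and>
    (\<forall>s. s \<noteq> 0 \<longrightarrow> lessM 0 s)"

lift_definition lcm_mon :: "'n::finite mon \<Rightarrow> 'n mon \<Rightarrow> 'n mon"
  is "\<lambda>s t i. max (s i) (t i)"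
  by simp

definition const :: "'a::comm_ring_1 \<Rightarrow> ('n::finite, 'a) mpoly"
  where "const c = Poly_Mapping.single 0 c"

text \<open>\<open>lm\<close> and \<open>lc\<close> are only meaningful for nonzero polynomials.\<close>

definition lm :: "('n::finite mon \<Rightarrow> 'n mon \<Rightarrow> bool) \<Rightarrow> ('n, 'a::comm_ring_1) mpoly \<Rightarrow> 'n mon"
  where "lm lessM p = (THE s. s \<in> Poly_Mapping.keys p \<and>
    (\<forall>t \<in> Poly_Mapping.keys p. t \<noteq> s \<longrightarrow> lessM t s))"

definition lc :: "('n::finite mon \<Rightarrow> 'n mon \<Rightarrow> bool) \<Rightarrow> ('n, 'a::comm_ring_1) mpoly \<Rightarrow> 'a"
  where "lc lessM p = Poly_Mapping.lookup p (lm lessM p)"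

definition lt :: "('n::finite mon \<Rightarrow> 'n mon \<Rightarrow> bool) \<Rightarrow> ('n, 'a::comm_ring_1) mpoly \<Rightarrow> ('n, 'a) mpoly"
  where "lt lessM p = Poly_Mapping.single (lm lessM p) (lc lessM p)"

definition lead_ideal ::
    "('n::finite mon \<Rightarrow> 'n mon \<Rightarrow> bool) \<Rightarrow> ('n, 'a::comm_ring_1) mpoly set \<Rightarrow> ('n, 'a) mpoly set"
  where "lead_ideal lessM F = ideal.span (lt lessM ` (F - {0}))"

definition groebner_basis ::
    "('n::finite mon \<Rightarrow> 'n mon \<Rightarrow> bool) \<Rightarrow> ('n, 'a::comm_ring_1) mpoly set \<Rightarrow> ('n, 'a) mpoly set \<Rightarrow> bool"
  where "groebner_basis lessM G J \<longleftrightarrow>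
    finite G \<and> G \<subseteq> J \<and> lead_ideal lessM G = lead_ideal lessM J"

definition strong_groebner_basis ::
    "('n::finite mon \<Rightarrow> 'n mon \<Rightarrow> bool) \<Rightarrow> ('n, 'a::comm_ring_1) mpoly set \<Rightarrow> ('n, 'a) mpoly set \<Rightarrow> bool"
  where "strong_groebner_basis lessM G J \<longleftrightarrow>
    groebner_basis lessM G J \<and>
    (\<forall>f \<in> J - {0}. \<exists>g \<in> G - {0}. lt lessM g dvd lt lessM f)"

text \<open>
  The combination of \<open>p\<close> from the basis modulo \<open>a\<close> and \<open>q\<close> from the basis modulo \<open>b\<close>:
  \<open>u a (lcm / lm q) lc(p) q + v b (lcm / lm p) lc(q) p\<close>, where \<open>lcm\<close> is that of \<open>lm p\<close> and \<open>lm q\<close>.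
\<close>

definition combine ::
    "('n::finite mon \<Rightarrow> 'n mon \<Rightarrow> bool) \<Rightarrow> 'a \<Rightarrow> 'a \<Rightarrow> 'a \<Rightarrow> 'a \<Rightarrow>
      ('n, 'a::comm_ring_1) mpoly \<Rightarrow> ('n, 'a) mpoly \<Rightarrow> ('n, 'a) mpoly"
  where "combine lessM a b u v p q =
    (if p = 0 \<or> q = 0 then 0
     else
       (let m = lcm_mon (lm lessM p) (lm lessM q) in
          Poly_Mapping.single (m - lm lessM q) (u * a * lc lessM p) * q +
          Poly_Mapping.single (m - lm lessM p) (v * b * lc lessM q) * p))"

end

theory Submission
  imports Defs
begin

text \<open>
  Since \<open>a b = 0\<close>, multiplication by \<open>b\<close> maps \<open>I + a R[x]\<close> into \<open>I\<close>, and likewise with \<open>a\<close> and \<open>b\<close>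
  exchanged; hence the combinations lie in \<open>I\<close>. Given a nonzero \<open>f\<close> in \<open>I\<close>, choose \<open>p\<close> and \<open>q\<close> in the
  two bases whose lead terms divide that of \<open>f\<close> and whose lead coefficients divide \<open>a\<close> and \<open>b\<close>. These
  coefficients are comaximal, so their product divides \<open>lc f\<close>; in particular it is nonzero, and
  therefore it is the lead coefficient of the combination of \<open>p\<close> and \<open>q\<close>, at the monomial
  \<open>lcm (lm p) (lm q)\<close>. A constant basis element need not divide \<open>a\<close>, but it can be replaced by
  one that generates all constants of \<open>I + a R[x]\<close>; this is where principality of ideals enters.
\<close>

text \<open>Interpreting \<open>module\<close> with multiplication makes \<open>x * (y * z) = (x * y) * z\<close> a simp rule,
  which loops against \<open>mult.assoc\<close>.\<close>

declare ideal.scale_scale [simp del]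

section \<open>Divisibility of terms and monomials\<close>

lemma single_mult_lookup_add:
  fixes h :: "'m::cancel_comm_monoid_add \<Rightarrow>\<^sub>0 'a::comm_ring_1"
  shows "Poly_Mapping.lookup (Poly_Mapping.single m c * h) (m + t) = c * Poly_Mapping.lookup h t"
  by (simp add: lookup_mult lookup_single when_mult)

text \<open>Every monomial of a multiple of a term is a shift of the monomial of that term; the
  coefficient at the shift \<open>m + t\<close> then gives \<open>d\<close> as a multiple of
  \<open>c\<close>.\<close>

lemma single_dvd_singleD:
  fixes m n :: "'n::finite mon" and c d :: "'a::comm_ring_1"
  assumes "Poly_Mapping.single m c dvd Poly_Mapping.single n d" and "d \<noteq> 0"
  shows "\<exists>t. n = m + t" and "c dvd d"
proof -
  obtain h where h: "Poly_Mapping.single n d = Poly_Mapping.single m c * h"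
    using assms(1) by (elim dvdE)
  have "n \<in> Poly_Mapping.keys (Poly_Mapping.single m c * h)"
    using assms(2) by (simp flip: h)
  then obtain t where t: "n = m + t"
    using keys_mult[of "Poly_Mapping.single m c" h] by (auto split: if_splits)
  have "d = c * Poly_Mapping.lookup h t"
    using single_mult_lookup_add[of m c h t] by (simp flip: h t)
  with t show "\<exists>t. n = m + t" "c dvd d" by auto
qed

lemma single_dvd_single:
  fixes m t :: "'n::finite mon" and c d :: "'a::comm_ring_1"
  assumes "c dvd d"
  shows "Poly_Mapping.single m c dvd Poly_Mapping.single (m + t) d"
proof -
  obtain e where "d = c * e" using assms by (elim dvdE)
  then have "Poly_Mapping.single (m + t) d = Poly_Mapping.single m c * Poly_Mapping.single t e"
    by (simp add: mult_single)
  then show ?thesis by (rule dvdI)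
qed

lemma lcm_mon_left: "lcm_mon s t = s + (lcm_mon s t - s)"
  and lcm_mon_right: "lcm_mon s t = t + (lcm_mon s t - t)"
  by (transfer; auto simp: fun_eq_iff)+

text \<open>Subtraction of exponents is truncated, so the equation in the conclusion expresses that
  the lcm divides \<open>w\<close>.\<close>

lemma lcm_mon_least:
  assumes "w = s + s'" and "w = t + t'"
  shows "w = lcm_mon s t + (w - lcm_mon s t)"
  using assms
proof transfer
  fix w s s' t t' :: "'a \<Rightarrow> nat"
  assume "w = (\<lambda>k. s k + s' k)" "w = (\<lambda>k. t k + t' k)"
  then have "max (s i) (t i) \<le> w i" for i
    by (metis le_add1 max.bounded_iff)
  then show "w = (\<lambda>k. max (s k) (t k) + (w k - max (s k) (t k)))"
    by (auto simp: fun_eq_iff)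
qed

section \<open>Constants and sums of an ideal with a principal ideal\<close>

lemma const_add: "const (c + d) = const c + const d"
  and const_mult: "const (c * d) = const c * const d"
  and const_zero [simp]: "const 0 = 0"
  and const_eq_0_iff [simp]: "const c = 0 \<longleftrightarrow> c = 0"
proof -
  show "const c = 0 \<longleftrightarrow> c = 0"
    unfolding const_def by (metis single_zero lookup_single_eq lookup_zero)
qed (simp_all add: const_def single_add mult_single)

lemma ideal_sum_spanE:
  fixes J :: "'a::comm_ring_1 set"
  assumes "p \<in> J + ideal.span {c}"
  obtains i h where "i \<in> J" "p = i + h * c"
  using assms by (auto simp: set_plus_def ideal.span_singleton)

lemma subset_ideal_sum_span: "(J :: 'a::comm_ring_1 set) \<subseteq> J + ideal.span {c}"
proof
  fix x assume "x \<in> J"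
  then have "x + 0 \<in> J + ideal.span {c}" by (intro set_plus_intro ideal.span_zero)
  then show "x \<in> J + ideal.span {c}" by simp
qed

lemma generator_in_ideal_sum_span:
  fixes J :: "'a::comm_ring_1 set"
  assumes "ideal.subspace J"
  shows "c \<in> J + ideal.span {c}"
proof -
  have "0 + c \<in> J + ideal.span {c}"
    using assms by (intro set_plus_intro ideal.subspace_0 ideal.span_base) simp_all
  then show ?thesis by simp
qed

lemma subspace_ideal_sum_span:
  assumes "ideal.subspace (J :: 'a::comm_ring_1 set)"
  shows "ideal.subspace (J + ideal.span {c})"
proof (rule ideal.subspaceI)
  show "0 \<in> J + ideal.span {c}"
    using subset_ideal_sum_span ideal.subspace_0[OF assms] by (rule subsetD)
next
  fix x y assume "x \<in> J + ideal.span {c}" and "y \<in> J + ideal.span {c}"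
  then obtain i k i' k' where x: "x = i + k" "i \<in> J" "k \<in> ideal.span {c}"
    and y: "y = i' + k'" "i' \<in> J" "k' \<in> ideal.span {c}"
    by (elim set_plus_elim)
  have "(i + i') + (k + k') \<in> J + ideal.span {c}"
    using x y assms by (intro set_plus_intro ideal.subspace_add ideal.span_add)
  then show "x + y \<in> J + ideal.span {c}" unfolding x(1) y(1) by (simp only: ac_simps)
next
  fix r x assume "x \<in> J + ideal.span {c}"
  then obtain i k where x: "x = i + k" "i \<in> J" "k \<in> ideal.span {c}"
    by (rule set_plus_elim)
  have "r * i + r * k \<in> J + ideal.span {c}"
    using x assms by (intro set_plus_intro ideal.subspace_scale ideal.span_scale)
  then show "r * x \<in> J + ideal.span {c}" unfolding x(1) by (simp only: distrib_left)
qed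

text \<open>Turns an ideal of polynomials into one of coefficients, to which principality
  applies.\<close>

lemma subspace_const_vimage:
  assumes "ideal.subspace (J :: ('n::finite, 'a::comm_ring_1) mpoly set)"
  shows "ideal.subspace (const -` J)"
  using assms by (auto simp: ideal.subspace_def const_add const_mult)

text \<open>Writing \<open>p = i + h * c\<close> with \<open>i\<close> in \<open>J\<close>, the
  factor \<open>d\<close> kills the second summand.\<close>

lemma mult_ideal_sum_span_mem:
  fixes J :: "'a::comm_ring_1 set"
  assumes "ideal.subspace J" and "p \<in> J + ideal.span {c}" and "d * c = 0"
  shows "d * p \<in> J"
proof -
  obtain i h where ih: "i \<in> J" "p = i + h * c" using assms(2) by (rule ideal_sum_spanE)
  have "d * p = d * i + h * (d * c)" unfolding ih(2) by (simp only: algebra_simps)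
  also have "\<dots> = d * i" using assms(3) by simp
  finally show ?thesis using ideal.subspace_scale[OF assms(1) ih(1)] by simp
qed

section \<open>Criterion for strong bases, and membership of the combinations\<close>

lemma lead_ideal_mono: "F \<subseteq> H \<Longrightarrow> lead_ideal lessM F \<subseteq> lead_ideal lessM H"
  unfolding lead_ideal_def by (intro ideal.span_mono) auto

text \<open>Equality of the lead ideals follows from divisibility of lead terms, so only the latter
  has to be checked.\<close>

lemma strong_groebner_basisI:
  assumes "finite G" and "G \<subseteq> J"
    and dvd: "\<And>f. f \<in> J \<Longrightarrow> f \<noteq> 0 \<Longrightarrow> \<exists>g \<in> G - {0}. lt lessM g dvd lt lessM f"
  shows "strong_groebner_basis lessM G J"
proof -
  have "lt lessM f \<in> lead_ideal lessM G" if f: "f \<in> J" "f \<noteq> 0" for f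
  proof -
    obtain g where g: "g \<in> G - {0}" "lt lessM g dvd lt lessM f" using dvd[OF f] by blast
    then obtain h where "lt lessM f = h * lt lessM g" by (metis dvdE mult.commute)
    with g show ?thesis unfolding lead_ideal_def
      by (simp add: ideal.span_base ideal.span_scale)
  qed
  then have "lead_ideal lessM J \<subseteq> lead_ideal lessM G"
    unfolding lead_ideal_def[of lessM J]
    by (intro ideal.span_minimal) (auto simp: lead_ideal_def)
  with assms lead_ideal_mono[of G J lessM] show ?thesis
    unfolding strong_groebner_basis_def groebner_basis_def by blast
qed

text \<open>The factor \<open>v * b\<close> in front of \<open>p\<close> annihilates
  \<open>a\<close>, and \<open>u * a\<close> in front of \<open>q\<close> annihilates
  \<open>b\<close>.\<close>

lemma combine_mem:
  assumes "ideal.subspace I" and "a * b = 0"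
    and "p \<in> I + ideal.span {const a}" and "q \<in> I + ideal.span {const b}"
  shows "combine lessM a b u v p q \<in> I"
proof -
  have "v * b * c * a = v * c * (a * b)" and "u * a * c * b = u * c * (a * b)" for c
    by (simp_all only: ac_simps)
  then have "v * b * c * a = 0" and "u * a * c * b = 0" for c
    using assms(2) by simp_all
  then have "Poly_Mapping.single m (v * b * c) * const a = 0"
    and "Poly_Mapping.single m (u * a * c) * const b = 0" for m :: "'a mon" and c
    by (simp_all add: const_def mult_single)
  then have *: "Poly_Mapping.single m (v * b * c) * p \<in> I"
    and **: "Poly_Mapping.single m (u * a * c) * q \<in> I" for m c
    using mult_ideal_sum_span_mem[OF assms(1,3)] mult_ideal_sum_span_mem[OF assms(1,4)] by blast+
  show ?thesis unfolding combine_def Let_def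
    using assms(1) * ** by (auto intro: ideal.subspace_add ideal.subspace_0)
qed

section \<open>Lead data for a fixed global order\<close>

context
  fixes lessM :: "'n::finite mon \<Rightarrow> 'n mon \<Rightarrow> bool"
  assumes ord: "global_monomial_order lessM"
begin

lemma lessM_asym: "lessM s t \<Longrightarrow> \<not> lessM t s"
  using ord unfolding global_monomial_order_def irreflp_def transp_def by blast

lemma lm_eqI:
  assumes "s \<in> Poly_Mapping.keys p" and "\<And>t. t \<in> Poly_Mapping.keys p \<Longrightarrow> t \<noteq> s \<Longrightarrow> lessM t s"
  shows "lm lessM p = s"
  unfolding lm_def
proof (rule the_equality)
  fix s' assume "s' \<in> Poly_Mapping.keys p \<and> (\<forall>t \<in> Poly_Mapping.keys p. t \<noteq> s' \<longrightarrow> lessM t s')"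
  then show "s' = s" using assms lessM_asym by metis
qed (use assms in blast)

lemma
  assumes "p \<noteq> 0"
  shows lm_in_keys: "lm lessM p \<in> Poly_Mapping.keys p"
    and less_lm: "t \<in> Poly_Mapping.keys p \<Longrightarrow> t \<noteq> lm lessM p \<Longrightarrow> lessM t (lm lessM p)"
proof -
  have "Poly_Mapping.keys p \<noteq> {}" using assms by simp
  moreover have "transp_on (Poly_Mapping.keys p) lessM" "totalp_on (Poly_Mapping.keys p) lessM"
    using ord unfolding global_monomial_order_def transp_on_def totalp_on_def by blast+
  ultimately obtain s where s: "s \<in> Poly_Mapping.keys p" "\<forall>t \<in> Poly_Mapping.keys p. t \<noteq> s \<longrightarrow> lessM t s"
    using Finite_Set.bex_greatest_element[OF finite_keys, of p lessM] by blast
  have "lm lessM p = s" by (rule lm_eqI) (use s in blast)+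
  with s show "lm lessM p \<in> Poly_Mapping.keys p"
    "t \<in> Poly_Mapping.keys p \<Longrightarrow> t \<noteq> lm lessM p \<Longrightarrow> lessM t (lm lessM p)"
    by blast+
qed

lemma lc_nonzero: "p \<noteq> 0 \<Longrightarrow> lc lessM p \<noteq> 0"
  unfolding lc_def using lm_in_keys by (simp add: in_keys_iff)

lemma lm_const: "c \<noteq> 0 \<Longrightarrow> lm lessM (const c) = 0"
  by (rule lm_eqI) (auto simp: const_def)

lemma lt_const: "c \<noteq> 0 \<Longrightarrow> lt lessM (const c) = const c"
  \<comment> \<open>\<open>lm_const\<close> speaks of the folded \<open>const\<close>, so
    \<open>const_def\<close> is unfolded only in a second pass.\<close>
  by (simp add: lt_def lc_def lm_const) (simp add: const_def)

text \<open>This is where globality enters: no monomial lies below 1.\<close>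

lemma lm_eq_0_imp_const:
  assumes "p \<noteq> 0" and "lm lessM p = 0"
  shows "p = const (lc lessM p)"
proof -
  have "t = 0" if "t \<in> Poly_Mapping.keys p" for t
  proof (rule ccontr)
    assume "t \<noteq> 0"
    then have "lessM t 0" using less_lm[OF assms(1) that] assms(2) by simp
    moreover have "lessM 0 t" using ord \<open>t \<noteq> 0\<close> unfolding global_monomial_order_def by blast
    ultimately show False using lessM_asym by blast
  qed
  then have "Poly_Mapping.lookup p t = (lc lessM p when 0 = t)" for t
    unfolding lc_def assms(2) by (cases "t = 0") (auto simp: in_keys_iff)
  then show ?thesis by (intro poly_mapping_eqI) (simp add: const_def lookup_single)
qed

lemma lt_dvdD:
  assumes "lt lessM g dvd lt lessM f" and "f \<noteq> 0"
  shows "\<exists>t. lm lessM f = lm lessM g + t" and "lc lessM g dvd lc lessM f"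
  using single_dvd_singleD[OF assms(1)[unfolded lt_def] lc_nonzero[OF assms(2)]] by auto

text \<open>Only an upper bound: with zero divisors, \<open>c\<close> may kill the lead coefficient
  of \<open>p\<close>, and then \<open>m + lm lessM p\<close> does not occur in the product.\<close>

lemma keys_single_mult_less:
  assumes "p \<noteq> 0" and "t \<in> Poly_Mapping.keys (Poly_Mapping.single m c * p)" and "t \<noteq> m + lm lessM p"
  shows "lessM t (m + lm lessM p)"
proof -
  obtain s where s: "s \<in> Poly_Mapping.keys p" "t = m + s"
    using assms(2) keys_mult[of "Poly_Mapping.single m c" p] by (auto split: if_splits)
  then have "lessM s (lm lessM p)" using less_lm[OF assms(1)] assms(3) by blast
  with s ord show ?thesis unfolding global_monomial_order_def by (metis add.commute)
qed

text \<open>Since \<open>u a\<close> and \<open>v b\<close> sum to one, the lead coefficients multiply.\<close>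

lemma combine_lead:
  assumes "1 = u * a + v * b" and "p \<noteq> 0" and "q \<noteq> 0" and "lc lessM p * lc lessM q \<noteq> 0"
  shows "combine lessM a b u v p q \<noteq> 0"
    and "lt lessM (combine lessM a b u v p q) =
      Poly_Mapping.single (lcm_mon (lm lessM p) (lm lessM q)) (lc lessM p * lc lessM q)"
proof -
  define m where "m = lcm_mon (lm lessM p) (lm lessM q)"
  define A where "A = Poly_Mapping.single (m - lm lessM q) (u * a * lc lessM p) * q"
  define B where "B = Poly_Mapping.single (m - lm lessM p) (v * b * lc lessM q) * p"
  have c: "combine lessM a b u v p q = A + B"
    using assms(2,3) unfolding combine_def Let_def A_def B_def m_def by simp
  have mq: "m = (m - lm lessM q) + lm lessM q" and mp: "m = (m - lm lessM p) + lm lessM p"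
    unfolding m_def by (subst add.commute, rule lcm_mon_right lcm_mon_left)+
  have "Poly_Mapping.lookup A m = u * a * lc lessM p * lc lessM q"
    by (subst mq) (simp only: A_def single_mult_lookup_add lc_def)
  moreover have "Poly_Mapping.lookup B m = v * b * lc lessM q * lc lessM p"
    by (subst mp) (simp only: B_def single_mult_lookup_add lc_def)
  ultimately have "Poly_Mapping.lookup (A + B) m = (u * a + v * b) * (lc lessM p * lc lessM q)"
    by (simp only: lookup_add ring_distribs ac_simps)
  then have l: "Poly_Mapping.lookup (A + B) m = lc lessM p * lc lessM q"
    by (simp only: assms(1)[symmetric] mult_1_left)
  \<comment> \<open>Either summand may lack the monomial \<open>m\<close>; the sum has it because
    the product of the lead coefficients is nonzero.\<close>
  then have k: "m \<in> Poly_Mapping.keys (A + B)" using assms(4) by (simp add: in_keys_iff)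
  have "lessM t m" if "t \<in> Poly_Mapping.keys (A + B)" "t \<noteq> m" for t
  proof -
    have "t \<in> Poly_Mapping.keys A \<or> t \<in> Poly_Mapping.keys B" using that(1) keys_add[of A B] by blast
    then show ?thesis
    proof
      assume "t \<in> Poly_Mapping.keys A"
      then show ?thesis
        using keys_single_mult_less[OF assms(3), where t = t and m = "m - lm lessM q"] that(2)
        unfolding A_def mq[symmetric] by blast
    next
      assume "t \<in> Poly_Mapping.keys B"
      then show ?thesis
        using keys_single_mult_less[OF assms(2), where t = t and m = "m - lm lessM p"] that(2)
        unfolding B_def mp[symmetric] by blast
    qed
  qed
  then have "lm lessM (A + B) = m" using k by (intro lm_eqI)
  then show "lt lessM (combine lessM a b u v p q) =
      Poly_Mapping.single (lcm_mon (lm lessM p) (lm lessM q)) (lc lessM p * lc lessM q)"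
    by (simp add: lt_def lc_def c l flip: m_def)
  show "combine lessM a b u v p q \<noteq> 0" using k c by auto
qed

text \<open>The constants in \<open>J\<close> form a principal ideal of coefficients. A basis
  element whose lead term divides its generator \<open>e\<close> has lead monomial 1, hence is
  itself a constant, and it divides \<open>e\<close>.\<close>

lemma strong_groebner_basis_generator_of_consts:
  fixes J :: "('n, 'a::comm_ring_1) mpoly set"
  assumes "principal_ideal_ring TYPE('a)" and "ideal.subspace J"
    and "strong_groebner_basis lessM G J" and "const c \<in> J" and "c \<noteq> 0"
  shows "\<exists>d. const d \<in> G - {0} \<and> (\<forall>x. const x \<in> J \<longrightarrow> d dvd x)"
proof -
  obtain e where e: "const -` J = ideal.span {e}"
    using assms(1) subspace_const_vimage[OF assms(2)] unfolding principal_ideal_ring_def by blast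
  then have e_dvd: "e dvd x" if "const x \<in> J" for x
    using that by (auto simp: ideal.span_singleton set_eq_iff dvd_def mult.commute)
  have "const e \<in> J" using e ideal.span_base[of e "{e}"] by auto
  moreover have "e \<noteq> 0" using e_dvd[OF assms(4)] assms(5) by auto
  ultimately obtain g where g: "g \<in> G - {0}" "lt lessM g dvd lt lessM (const e)"
    using assms(3) unfolding strong_groebner_basis_def by (metis Diff_iff const_eq_0_iff singletonD insertI1 DiffI)
  note D = lt_dvdD[OF g(2)]
  obtain t where "lm lessM g + t = 0" using D(1) \<open>e \<noteq> 0\<close> by (auto simp: lm_const)
  \<comment> \<open>Exponents are natural numbers, so both summands vanish.\<close>
  then have "Poly_Mapping.lookup (lm lessM g + t) i = 0" for i by simp
  then have "lm lessM g = 0" by (intro poly_mapping_eqI) (simp add: lookup_add)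
  then have "g = const (lc lessM g)" using g lm_eq_0_imp_const by blast
  moreover have "lc lessM g dvd e" using D(2) \<open>e \<noteq> 0\<close> by (simp add: lc_def lm_const) (simp add: const_def)
  ultimately show ?thesis using g(1) e_dvd dvd_trans by metis
qed

text \<open>If the divisor supplied by the strong basis is a constant, the generator of all
  constants replaces it. That generator divides the old constant, so its lead term still divides
  that of \<open>f\<close>.\<close>

lemma strong_groebner_basis_obtain:
  fixes I :: "('n, 'a::comm_ring_1) mpoly set"
  assumes "principal_ideal_ring TYPE('a)" and "ideal.subspace I"
    and G: "strong_groebner_basis lessM G (I + ideal.span {const a})"
    and lc_dvd: "\<And>g. g \<in> G \<Longrightarrow> g \<notin> range const \<Longrightarrow> lc lessM g dvd a"
    and "f \<in> I" "f \<noteq> 0"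
  obtains g where "g \<in> G" "g \<noteq> 0" "lt lessM g dvd lt lessM f" "lc lessM g dvd a"
proof -
  let ?J = "I + ideal.span {const a}"
  have "f \<in> ?J" using \<open>f \<in> I\<close> subset_ideal_sum_span by blast
  then obtain g where g: "g \<in> G" "g \<noteq> 0" "lt lessM g dvd lt lessM f"
    using G \<open>f \<noteq> 0\<close> unfolding strong_groebner_basis_def by blast
  show ?thesis
  proof (cases "g \<in> range const")
    case False
    with g lc_dvd that show ?thesis by blast
  next
    case True
    then obtain c where c: "g = const c" by blast
    have "const c \<in> ?J" using g c G unfolding strong_groebner_basis_def groebner_basis_def by blast
    moreover have "c \<noteq> 0" using g c by simp
    ultimately obtain d where d: "const d \<in> G - {0}" "\<And>x. const x \<in> ?J \<Longrightarrow> d dvd x"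
      using strong_groebner_basis_generator_of_consts[OF assms(1) subspace_ideal_sum_span[OF assms(2)] G]
      by blast
    have "const d dvd const c" using d(2)[OF \<open>const c \<in> ?J\<close>]
      by (auto simp: const_mult elim!: dvdE)
    moreover have "d \<noteq> 0" using d(1) by auto
    ultimately have "lt lessM (const d) dvd lt lessM f"
      using g(3) \<open>c \<noteq> 0\<close> c by (simp add: lt_const) (erule dvd_trans)
    \<comment> \<open>\<open>const a\<close> itself lies in \<open>?J\<close>.\<close>
    moreover have "lc lessM (const d) dvd a"
      using d(2)[OF generator_in_ideal_sum_span[OF assms(2)]] \<open>d \<noteq> 0\<close>
      by (simp add: lc_def lm_const) (simp add: const_def)
    ultimately show ?thesis using d(1) that by blast
  qed
qed

end

text \<open>In \<open>z = u * (a * z) + v * (z * b)\<close>, \<open>x * y\<close> divides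
  \<open>a * z\<close> since \<open>x\<close> divides \<open>a\<close> and \<open>y\<close> divides
  \<open>z\<close>, and it divides \<open>z * b\<close> with the roles exchanged.\<close>

lemma mult_dvd_of_comaximal:
  fixes x y z :: "'a::comm_ring_1"
  assumes "1 = u * a + v * b" and "x dvd a" and "y dvd b" and "x dvd z" and "y dvd z"
  shows "x * y dvd z"
proof -
  have "x * y dvd a * z" and "x * y dvd z * b" using assms(2-5) by (blast intro: mult_dvd_mono)+
  then have "x * y dvd u * (a * z) + v * (z * b)" by (rule dvd_add[OF dvd_mult dvd_mult])
  also have "u * (a * z) + v * (z * b) = (u * a + v * b) * z" by (simp only: ring_distribs ac_simps)
  finally show ?thesis by (simp only: assms(1)[symmetric] mult_1_left)
qed

theorem theorem12:
  fixes lessM :: "'n::finite mon \<Rightarrow> 'n mon \<Rightarrow> bool"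
    and a b u v :: "'r::comm_ring_1"
    and I :: "('n, 'r) mpoly set"
    and K :: "'k set" and L :: "'l set"
    and ga :: "'k \<Rightarrow> ('n, 'r) mpoly" and gb :: "'l \<Rightarrow> ('n, 'r) mpoly"
  assumes "principal_ideal_ring TYPE('r)"
    and "global_monomial_order lessM"
    and "1 = u * a + v * b" and "a * b = 0"
    and "ideal.subspace I"
    and "finite K" and "finite L"
    and "strong_groebner_basis lessM (ga ` K) (I + ideal.span {const a})"
    and "strong_groebner_basis lessM (gb ` L) (I + ideal.span {const b})"
    and "\<And>k. k \<in> K \<Longrightarrow> ga k \<notin> range const \<Longrightarrow>
           lc lessM (ga k) dvd a \<and> lc lessM (ga k) \<notin> ideal.span {a}"
    and "\<And>l. l \<in> L \<Longrightarrow> gb l \<notin> range const \<Longrightarrow>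
           lc lessM (gb l) dvd b \<and> lc lessM (gb l) \<notin> ideal.span {b}"
  shows "strong_groebner_basis lessM
           {combine lessM a b u v (ga k) (gb l) | k l. k \<in> K \<and> l \<in> L} I"
    (is "strong_groebner_basis lessM ?G I")
proof (rule strong_groebner_basisI)
  show "finite ?G" using assms(6,7) by (simp add: finite_image_set2)
  have "ga k \<in> I + ideal.span {const a}" if "k \<in> K" for k
    using assms(8) that unfolding strong_groebner_basis_def groebner_basis_def by blast
  moreover have "gb l \<in> I + ideal.span {const b}" if "l \<in> L" for l
    using assms(9) that unfolding strong_groebner_basis_def groebner_basis_def by blast
  ultimately show "?G \<subseteq> I" using combine_mem[OF assms(5,4)] by blast
next
  fix f assume f: "f \<in> I" "f \<noteq> 0"
  obtain k where k: "k \<in> K" "ga k \<noteq> 0" "lt lessM (ga k) dvd lt lessM f" "lc lessM (ga k) dvd a"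
    by (rule strong_groebner_basis_obtain[OF assms(2,1,5,8) _ f]) (use assms(10) in auto)
  obtain l where l: "l \<in> L" "gb l \<noteq> 0" "lt lessM (gb l) dvd lt lessM f" "lc lessM (gb l) dvd b"
    by (rule strong_groebner_basis_obtain[OF assms(2,1,5,9) _ f]) (use assms(11) in auto)
  note dk = lt_dvdD[OF assms(2) k(3) f(2)] and dl = lt_dvdD[OF assms(2) l(3) f(2)]
  let ?m = "lcm_mon (lm lessM (ga k)) (lm lessM (gb l))"
  have c: "lc lessM (ga k) * lc lessM (gb l) dvd lc lessM f"
    using mult_dvd_of_comaximal[OF assms(3) k(4) l(4) dk(2) dl(2)] .
  \<comment> \<open>A divisor of the nonzero \<open>lc lessM f\<close> cannot be zero.\<close>
  then have nz: "lc lessM (ga k) * lc lessM (gb l) \<noteq> 0"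
    using lc_nonzero[OF assms(2) f(2)] by auto
  obtain t where t: "lm lessM f = ?m + t" using dk(1) dl(1) lcm_mon_least by blast
  have "lt lessM (combine lessM a b u v (ga k) (gb l)) dvd lt lessM f"
    unfolding combine_lead(2)[OF assms(2,3) k(2) l(2) nz] lt_def[of lessM f] t
    using c by (rule single_dvd_single)
  moreover have "combine lessM a b u v (ga k) (gb l) \<noteq> 0"
    using combine_lead(1)[OF assms(2,3) k(2) l(2) nz] .
  ultimately show "\<exists>g \<in> ?G - {0}. lt lessM g dvd lt lessM f" using k(1) l(1) by blast
qed

end
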